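(* Let $d \ge 2$ be an integer, let $p_1, \ldots, p_d \in \mathbb{N}$, set $p = p_1 + \dots + p_d$, let $\alpha$ be a real number with $2\alpha \in \mathbb{N} \cup (p-1, \infty)$, and let $\Sigma$ be a real symmetric positive semidefinite matrix of size $p \times p$. Let $\boldsymbol{X} = (X_1, \ldots, X_d)$ be a random vector with the multivariate trace-Wishart distribution $\mathrm{TW}_{p_1,\dots,p_d}(\alpha, \Sigma)$. Then for any collection $\phi_1, \dots, \phi_d$ of completely monotone functions on $(0,\infty)$ and any integer $d_1 \in \{1, \dots, d-1\}$, \[ \mathbb{E}\left\{\prod_{i=1}^d \phi_i(X_i)\right\} \geq \mathbb{E}\left\{\prod_{i=1}^{d_1} \phi_i(X_i)\right\} \, \mathbb{E}\left\{\prod_{i=d_1+1}^{d} \phi_i(X_i)\right\}, \] provided that the expectations exist (i.e., are finite).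
   Context: $\mathbb{N} = \{1, 2, \ldots\}$; $|\cdot|$ denotes the determinant and $\mathrm{I}_m$ the $m \times m$ identity matrix. Multivariate trace-Wishart distribution: for $d \ge 2$, $p_1, \ldots, p_d \in \mathbb{N}$, $p = p_1 + \dots + p_d$, $2\alpha \in \mathbb{N} \cup (p-1,\infty)$ and $\Sigma$ a $p \times p$ symmetric positive semidefinite matrix, a $d$-dimensional random vector $\boldsymbol{X}$ is said to follow $\mathrm{TW}_{p_1,\dots,p_d}(\alpha,\Sigma)$ if and only if, for all $\boldsymbol{t} = (t_1, \ldots, t_d) \in [0,\infty)^d$, \[ \mathbb{E}\big(e^{-\boldsymbol{t}^\top \boldsymbol{X}}\big) = \big| \mathrm{I}_p + \mathrm{diag}(t_1 \mathrm{I}_{p_1}, \dots, t_d \mathrm{I}_{p_d}) \, \Sigma \big|^{-\alpha}, \] where $\mathrm{diag}(\cdot)$ is the block-diagonal matrix. Equivalently, $\boldsymbol{X}$ has the same distribution as $(\mathrm{tr}(W_{11}), \ldots, \mathrm{tr}(W_{dd}))$, where $W \sim \mathrm{Wishart}_p(2\alpha, \Sigma/2)$ has diagonal blocks $W_{ii}$ of size $p_i \times p_i$; in particular its components are almost surely nonnegative. Completely monotone function: a function $\phi : (0,\infty) \to \mathbb{R}$ that is nonnegative, infinitely differentiable on $(0,\infty)$, and satisfies $(-1)^n \phi^{(n)}(t) \ge 0$ for every integer $n \in \mathbb{N}$ and every $t \in (0,\infty)$. In the degenerate case where $X_i$ may take the value $0$, $\phi_i(0)$ is understood as $\lim_{t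 \downarrow 0} \phi_i(t) \in [0,\infty]$. *)

theory Defs
  imports "HOL-Probability.Probability" "Jordan_Normal_Form.Determinant"
begin

text \<open>The matrix notions are those of Jordan_Normal_Form, where dimensions are natural
  numbers; HOL-Analysis has constants with some of the same base names, hence the qualifiers.\<close>

definition symmetric_psd :: "nat \<Rightarrow> real Matrix.mat \<Rightarrow> bool" where
  "symmetric_psd n A \<longleftrightarrow>
     A \<in> carrier_mat n n \<and>
     transpose_mat A = A \<and>
     (\<forall>v \<in> carrier_vec n. 0 \<le> Matrix.scalar_prod v (A *\<^sub>v v))"

definition diag_blocks :: "nat \<Rightarrow> (nat \<Rightarrow> nat) \<Rightarrow> (nat \<Rightarrow> real) \<Rightarrow> real Matrix.mat" where
  "diag_blocks d p t = diag_block_mat (map (\<lambda>i. t i \<cdot>\<^sub>m 1\<^sub>m (p i)) [1..<d + 1])"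

text \<open>A \<open>d\<close>-dimensional random vector is given by its components \<open>X 1, \<dots>, X d\<close>. The real power
  is harmless: for positive semidefinite \<open>\<Sigma>\<close> and nonnegative \<open>t\<close> the determinant is at least 1.\<close>

definition trace_wishart ::
  "'a measure \<Rightarrow> nat \<Rightarrow> (nat \<Rightarrow> nat) \<Rightarrow> real \<Rightarrow> real Matrix.mat \<Rightarrow> (nat \<Rightarrow> 'a \<Rightarrow> real) \<Rightarrow> bool" where
  "trace_wishart M d p \<alpha> \<Sigma> X \<longleftrightarrow>
     (\<forall>i \<in> {1..d}. X i \<in> borel_measurable M) \<and>
     (\<forall>t. (\<forall>i \<in> {1..d}. 0 \<le> t i) \<longrightarrow>
        has_bochner_integral M (\<lambda>\<omega>. exp (- (\<Sum>i=1..d. t i * X i \<omega>)))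
          (Determinant.det (1\<^sub>m (\<Sum>i=1..d. p i) + diag_blocks d p t * \<Sigma>) powr (- \<alpha>)))"

text \<open>A function on the open half-line is represented by a total function whose values at
  nonpositive arguments are ignored. The case \<open>n = 0\<close> expresses nonnegativity.\<close>

definition completely_monotone :: "(real \<Rightarrow> real) \<Rightarrow> bool" where
  "completely_monotone \<phi> \<longleftrightarrow>
     (\<forall>n. \<forall>t>0. (deriv ^^ n) \<phi> differentiable (at t) \<and> 0 \<le> (- 1) ^ n * (deriv ^^ n) \<phi> t)"

text \<open>Extension to 0 by the right limit, which may be infinite. The value at negative arguments
  is immaterial, because the components of a trace-Wishart vector are almost surely nonnegative.\<close>

definition extend_to_zero :: "(real \<Rightarrow> real) \<Rightarrow> real \<Rightarrow> ennreal" where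
  "extend_to_zero \<phi> x =
     (if 0 < x then ennreal (\<phi> x) else Lim (at_right 0) (\<lambda>t. ennreal (\<phi> t)))"

end

theory Submission
  imports Defs "HOL-Real_Asymp.Real_Asymp"
begin

text \<open>Completely monotone functions are limits of mixtures of exponentials, so both sides being
  linear in each \<open>\<phi> i\<close> reduces the claim to exponentials, that is, to submultiplicativity of
  \<open>t \<mapsto> det (I + diag t * \<Sigma>)\<close>. The latter holds because \<open>det (I + (D + a * e e\<^sup>T) * \<Sigma>) / det (I + D * \<Sigma>)\<close>
  equals \<open>1 + a * c\<close> with \<open>c\<close> a diagonal entry of \<open>(I + \<Sigma> * D)\<^sup>-\<^sup>1 * \<Sigma>\<close>, which is nonnegative and
  decreasing in \<open>D\<close>. Helly's theorem and Bernstein's representing measure are avoided: the Taylor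
  expansion of \<open>\<phi>\<close> about \<open>\<epsilon> + b\<close>, evaluated at \<open>\<epsilon> + b * (1 - exp (- x / b))\<close>, is already a series of
  exponentials in \<open>x\<close> with nonnegative coefficients, and it tends to \<open>\<phi> (\<epsilon> + x)\<close> as \<open>b\<close> grows.\<close>

subsection \<open>Submultiplicativity of the determinant\<close>

text \<open>The hypothesis on \<open>c\<close> says that it is column \<open>i\<close> of \<open>(I + S * diag x)\<^sup>-\<^sup>1 * S\<close>.\<close>

lemma resolvent_diag_antimono:
  fixes S :: "nat \<Rightarrow> nat \<Rightarrow> real" and x x' c c' :: "nat \<Rightarrow> real"
  assumes sym: "\<And>j l. j < n \<Longrightarrow> l < n \<Longrightarrow> S j l = S l j"
    and psd: "\<And>v. 0 \<le> (\<Sum>j<n. v j * (\<Sum>l<n. S j l * v l))"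
    and i: "i < n"
    and x: "\<And>j. j < n \<Longrightarrow> 0 \<le> x j" "\<And>j. j < n \<Longrightarrow> x j \<le> x' j"
    and c: "\<And>j. j < n \<Longrightarrow> c j = (\<Sum>l<n. S j l * (of_bool (l = i) - x l * c l))"
    and c': "\<And>j. j < n \<Longrightarrow> c' j = (\<Sum>l<n. S j l * (of_bool (l = i) - x' l * c' l))"
  shows "c' i \<le> c i"
proof -
  define e y y' where "e l = (of_bool (l = i) :: real)" and "y l = e l - x l * c l"
    and "y' l = e l - x' l * c' l" for l
  have cy: "c j = (\<Sum>l<n. S j l * y l)" "c' j = (\<Sum>l<n. S j l * y' l)" if "j < n" for j
    using c[OF that] c'[OF that] by (simp_all add: y_def y'_def e_def)
  \<comment> \<open>Here \<open>c = S y\<close> and \<open>c' = S y'\<close>. Positivity of the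
    quadratic form at \<open>y' - y\<close>, plus the square weighted by \<open>x\<close>, collapses
    to a bound whose only weight is \<open>x - x'\<close>.\<close>
  have "0 \<le> (\<Sum>j<n. (y' j - y j) * (\<Sum>l<n. S j l * (y' l - y l)))" by (rule psd)
  also have "\<dots> = (\<Sum>j<n. (y' j - y j) * (c' j - c j))"
    by (intro sum.cong refl) (simp add: cy right_diff_distrib sum_subtractf)
  finally have "0 \<le> (\<Sum>j<n. (y' j - y j) * (c' j - c j))" .
  moreover have "0 \<le> (\<Sum>j<n. x j * (c' j - c j)\<^sup>2)"
    by (intro sum_nonneg mult_nonneg_nonneg) (simp_all add: x)
  ultimately have "0 \<le> (\<Sum>j<n. (y' j - y j) * (c' j - c j) + x j * (c' j - c j)\<^sup>2)"
    by (simp add: sum.distrib)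
  also have "\<dots> = (\<Sum>j<n. (x j - x' j) * (c' j)\<^sup>2 - (x j - x' j) * (c j * c' j))"
    by (intro sum.cong refl) (simp add: y_def y'_def power2_eq_square algebra_simps)
  finally have *: "(\<Sum>j<n. (x j - x' j) * (c j * c' j)) \<le> (\<Sum>j<n. (x j - x' j) * (c' j)\<^sup>2)"
    by (simp add: sum_subtractf)
  \<comment> \<open>Both sums are the bilinear form of \<open>S\<close> at \<open>y\<close> and
    \<open>y'\<close>, equal by symmetry. This cancels the mixed terms when
    \<open>c' i - c i\<close> is expanded through \<open>e = y + x c = y' + x' c'\<close>.\<close>
  have "(\<Sum>j<n. y j * c' j) = (\<Sum>j<n. \<Sum>l<n. y j * (S j l * y' l))"
    by (intro sum.cong refl) (simp add: cy sum_distrib_left)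
  also have "\<dots> = (\<Sum>l<n. \<Sum>j<n. y j * (S j l * y' l))" by (rule sum.swap)
  also have "\<dots> = (\<Sum>l<n. y' l * c l)"
    by (intro sum.cong refl) (auto simp: cy sum_distrib_left sym intro!: sum.cong)
  finally have swap: "(\<Sum>j<n. y j * c' j) = (\<Sum>l<n. y' l * c l)" .
  have pick: "u i = (\<Sum>j<n. e j * u j)" for u
    using i by (simp add: e_def of_bool_def if_distrib[of "\<lambda>z. z * _"] sum.delta cong: if_cong)
  have "c' i - c i = (\<Sum>j<n. e j * c' j) - (\<Sum>j<n. e j * c j)"
    using pick[of c] pick[of c'] by simp
  also have "\<dots> = (\<Sum>j<n. (y j * c' j - y' j * c j) + (x j - x' j) * (c j * c' j))"
    unfolding sum_subtractf[symmetric]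
    by (intro sum.cong refl) (simp add: y_def y'_def algebra_simps)
  also have "\<dots> = (\<Sum>j<n. (x j - x' j) * (c j * c' j))"
    by (simp add: sum.distrib sum_subtractf swap)
  also have "\<dots> \<le> (\<Sum>j<n. (x j - x' j) * (c' j)\<^sup>2)" by (rule *)
  also have "\<dots> \<le> 0"
    by (intro sum_nonpos mult_nonpos_nonneg) (simp_all add: x)
  finally show ?thesis by simp
qed

text \<open>With \<open>y = e - x c\<close> one has \<open>c = S y\<close>, so \<open>c i\<close> is
  the quadratic form of \<open>S\<close> at \<open>y\<close> plus the squares of the
  \<open>c j\<close> weighted by \<open>x j\<close>.\<close>

lemma resolvent_diag_nonneg:
  fixes S :: "nat \<Rightarrow> nat \<Rightarrow> real" and x c :: "nat \<Rightarrow> real"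
  assumes psd: "\<And>v. 0 \<le> (\<Sum>j<n. v j * (\<Sum>l<n. S j l * v l))"
    and i: "i < n"
    and x: "\<And>j. j < n \<Longrightarrow> 0 \<le> x j"
    and c: "\<And>j. j < n \<Longrightarrow> c j = (\<Sum>l<n. S j l * (of_bool (l = i) - x l * c l))"
  shows "0 \<le> c i"
proof -
  define e y where "e l = (of_bool (l = i) :: real)" and "y l = e l - x l * c l" for l
  have cy: "c j = (\<Sum>l<n. S j l * y l)" if "j < n" for j
    using c[OF that] by (simp add: y_def e_def)
  have "0 \<le> (\<Sum>j<n. y j * (\<Sum>l<n. S j l * y l)) + (\<Sum>j<n. x j * (c j)\<^sup>2)"
    by (intro add_nonneg_nonneg psd sum_nonneg) (simp_all add: x)
  also have "\<dots> = (\<Sum>j<n. e j * c j)"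
    unfolding sum.distrib[symmetric]
    by (intro sum.cong refl) (simp add: cy[symmetric], simp add: y_def power2_eq_square algebra_simps)
  also have "\<dots> = c i"
    using i by (simp add: e_def of_bool_def if_distrib[of "\<lambda>z. z * _"] sum.delta cong: if_cong)
  finally show ?thesis .
qed

section \<open>Determinants under a nonnegative diagonal perturbation\<close>

lemma symmetric_psdD:
  assumes "symmetric_psd n A"
  shows "A \<in> carrier_mat n n"
    and "\<And>j l. j < n \<Longrightarrow> l < n \<Longrightarrow> A $$ (j, l) = A $$ (l, j)"
    and "\<And>v. 0 \<le> (\<Sum>j<n. v j * (\<Sum>l<n. A $$ (j, l) * v l))"
proof -
  show A: "A \<in> carrier_mat n n" using assms by (simp add: symmetric_psd_def)
  show "A $$ (j, l) = A $$ (l, j)" if "j < n" "l < n" for j l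
    using assms that A unfolding symmetric_psd_def
    by (metis carrier_matD index_transpose_mat(1))
  show "0 \<le> (\<Sum>j<n. v j * (\<Sum>l<n. A $$ (j, l) * v l))" for v
  proof -
    have "0 \<le> Matrix.scalar_prod (Matrix.vec n v) (A *\<^sub>v Matrix.vec n v)"
      using assms by (simp add: symmetric_psd_def)
    also have "\<dots> = (\<Sum>j<n. v j * (\<Sum>l<n. A $$ (j, l) * v l))"
      using A by (simp add: scalar_prod_def lessThan_atLeast0)
    finally show ?thesis .
  qed
qed

text \<open>The diagonal stands on the right so that changing \<open>x i\<close> alters column
  \<open>i\<close> alone, the situation of Cramer's rule.\<close>

definition det_one_plus :: "real Matrix.mat \<Rightarrow> (nat \<Rightarrow> real) \<Rightarrow> real" where
  "det_one_plus A x = Determinant.det (1\<^sub>m (dim_row A) + A * mat_diag (dim_row A) x)"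

text \<open>Transposition exchanges the two products because \<open>A\<close> is symmetric. The form
  on the left is the one occurring in \<open>trace_wishart\<close>.\<close>

lemma det_one_plus_alt:
  assumes "symmetric_psd n A"
  shows "Determinant.det (1\<^sub>m n + mat_diag n x * A) = det_one_plus A x"
proof -
  note A = symmetric_psdD(1)[OF assms]
  have "transpose_mat (1\<^sub>m n + mat_diag n x * A) = 1\<^sub>m n + A * mat_diag n x"
    using symmetric_psdD(2)[OF assms] A
    by (intro eq_matI) (auto simp: mat_diag_mult_left[OF A] mat_diag_mult_right[OF A])
  moreover have "1\<^sub>m n + mat_diag n x * A \<in> carrier_mat n n"
    using A by (intro add_carrier_mat mult_carrier_mat[of _ n n]) auto
  ultimately show ?thesis using A det_transpose unfolding det_one_plus_def
    by (metis carrier_matD(1))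
qed

text \<open>With \<open>C = I + A * diag x\<close>, the vector \<open>c\<close> solves
  \<open>C c = col A i\<close>. Adding \<open>a\<close> to \<open>x i\<close> replaces column
  \<open>i\<close> of \<open>C\<close> by \<open>C (e + a c)\<close>, where \<open>e\<close> is the
  unit vector of index \<open>i\<close>; by Cramer's rule the determinant is multiplied by entry
  \<open>i\<close> of \<open>e + a c\<close>.\<close>

lemma det_one_plus_resolvent:
  assumes A: "A \<in> carrier_mat n n" and i: "i < n" and nz: "det_one_plus A x \<noteq> 0"
  obtains c where "\<And>j. j < n \<Longrightarrow> c j = (\<Sum>l<n. A $$ (j, l) * (of_bool (l = i) - x l * c l))"
    and "\<And>a. det_one_plus A (x(i := x i + a)) = det_one_plus A x * (1 + a * c i)"
proof -
  define C where "C = 1\<^sub>m n + A * mat_diag n x"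
  have C: "C \<in> carrier_mat n n" using A by (simp add: C_def)
  have dC: "Determinant.det C = det_one_plus A x" using A by (simp add: C_def det_one_plus_def)
  \<comment> \<open>The inverse of \<open>C\<close> applied to column \<open>i\<close> of
    \<open>A\<close>, with the inverse written through the adjugate.\<close>
  define v where "v = (1 / Determinant.det C) \<cdot>\<^sub>v (adj_mat C *\<^sub>v col A i)"
  have adj: "adj_mat C \<in> carrier_mat n n" using adj_mat[OF C] by simp
  have colA: "col A i \<in> carrier_vec n" using A by (simp add: carrier_vecI)
  have v: "v \<in> carrier_vec n" using adj colA by (simp add: v_def)
  have Cv: "C *\<^sub>v v = col A i"
  proof -
    have "C *\<^sub>v v = (1 / Determinant.det C) \<cdot>\<^sub>v (C *\<^sub>v (adj_mat C *\<^sub>v col A i))"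
      unfolding v_def using C adj colA by (intro mult_mat_vec mult_mat_vec_carrier)
    also have "C *\<^sub>v (adj_mat C *\<^sub>v col A i) = (C * adj_mat C) *\<^sub>v col A i"
      using C adj colA by (simp add: assoc_mult_mat_vec[of _ n n _ n])
    also have "\<dots> = Determinant.det C \<cdot>\<^sub>v (1\<^sub>m n *\<^sub>v col A i)"
      unfolding adj_mat(2)[OF C] using colA A
      by (intro eq_vecI)
        (auto simp: scalar_prod_def mult.assoc if_distrib[of "\<lambda>z. z * _"] simp flip: sum_distrib_left
          cong: if_cong)
    also have "1\<^sub>m n *\<^sub>v col A i = col A i" using colA by simp
    finally show ?thesis using nz dC by (simp add: smult_smult_assoc)
  qed
  have entry: "C $$ (j, l) = of_bool (j = l) + A $$ (j, l) * x l" if "j < n" "l < n" for j l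
    using that A by (auto simp: C_def mat_diag_mult_right[OF A])
  have res: "v $ j = (\<Sum>l<n. A $$ (j, l) * (of_bool (l = i) - x l * v $ l))" if j: "j < n" for j
  proof -
    have "A $$ (j, i) = (C *\<^sub>v v) $ j" using Cv j i A by simp
    also have "\<dots> = (\<Sum>l<n. C $$ (j, l) * v $ l)"
      using C v j by (simp add: scalar_prod_def lessThan_atLeast0)
    also have "\<dots> = (\<Sum>l<n. of_bool (j = l) * v $ l) + (\<Sum>l<n. A $$ (j, l) * x l * v $ l)"
      unfolding sum.distrib[symmetric] using j by (intro sum.cong) (simp_all add: entry algebra_simps)
    also have "(\<Sum>l<n. of_bool (j = l) * v $ l) = v $ j"
      using j by (simp add: of_bool_def if_distrib[of "\<lambda>z. z * _"] sum.delta cong: if_cong)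
    finally have "v $ j = A $$ (j, i) - (\<Sum>l<n. A $$ (j, l) * x l * v $ l)" by simp
    also have "A $$ (j, i) = (\<Sum>l<n. A $$ (j, l) * of_bool (l = i))"
      using i by (simp add: of_bool_def if_distrib[of "\<lambda>z. _ * z"] sum.delta cong: if_cong)
    finally show ?thesis by (simp add: sum_subtractf right_diff_distrib mult.assoc)
  qed
  have upd: "det_one_plus A (x(i := x i + a)) = det_one_plus A x * (1 + a * v $ i)" for a
  proof -
    let ?u = "unit_vec n i + a \<cdot>\<^sub>v v"
    have u: "?u \<in> carrier_vec n" using v by simp
    have "C *\<^sub>v ?u = C *\<^sub>v unit_vec n i + C *\<^sub>v (a \<cdot>\<^sub>v v)"
      using C v by (simp add: mult_add_distrib_mat_vec[of _ n n])
    also have "C *\<^sub>v unit_vec n i = col C i" using C i by (auto intro!: eq_vecI)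
    also have "C *\<^sub>v (a \<cdot>\<^sub>v v) = a \<cdot>\<^sub>v col A i" using Cv C v by (simp add: mult_mat_vec)
    finally have Cu: "C *\<^sub>v ?u = col C i + a \<cdot>\<^sub>v col A i" .
    have "1\<^sub>m n + A * mat_diag n (x(i := x i + a)) = replace_col C (C *\<^sub>v ?u) i"
      unfolding Cu using A C i
      by (intro eq_matI)
        (auto simp: replace_col_def entry mat_diag_mult_right[OF A] algebra_simps)
    then have "det_one_plus A (x(i := x i + a)) = ?u $ i * Determinant.det C"
      using cramer_lemma_mat[OF C u i] A by (simp add: det_one_plus_def)
    then show ?thesis using v i by (simp add: dC)
  qed
  show ?thesis by (rule that[of "\<lambda>j. v $ j"]) (use res upd in auto)
qed

text \<open>Raising coordinate \<open>i\<close> by \<open>a\<close> multiplies the determinant by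
  \<open>1 + a * c i\<close>. Nonnegativity of \<open>c i\<close> gives the first claim; the second
  compares these factors at \<open>x\<close> and \<open>x'\<close>, cleared of denominators.\<close>

lemma det_one_plus_update:
  assumes psd: "symmetric_psd n A" and i: "i < n"
    and x: "\<And>j. j < n \<Longrightarrow> 0 \<le> x j" "\<And>j. j < n \<Longrightarrow> x j \<le> x' j"
    and pos: "0 < det_one_plus A x" "0 < det_one_plus A x'" and a: "0 \<le> a"
  shows "det_one_plus A x \<le> det_one_plus A (x(i := x i + a))"
    and "det_one_plus A (x'(i := x' i + a)) * det_one_plus A x
      \<le> det_one_plus A x' * det_one_plus A (x(i := x i + a))"
proof -
  note A = symmetric_psdD[OF psd]
  have nz: "det_one_plus A x \<noteq> 0" "det_one_plus A x' \<noteq> 0" using pos by simp_all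
  obtain c where c: "\<And>j. j < n \<Longrightarrow> c j = (\<Sum>l<n. A $$ (j, l) * (of_bool (l = i) - x l * c l))"
    "\<And>a. det_one_plus A (x(i := x i + a)) = det_one_plus A x * (1 + a * c i)"
    using det_one_plus_resolvent[OF A(1) i nz(1)] by blast
  obtain c' where c': "\<And>j. j < n \<Longrightarrow> c' j = (\<Sum>l<n. A $$ (j, l) * (of_bool (l = i) - x' l * c' l))"
    "\<And>a. det_one_plus A (x'(i := x' i + a)) = det_one_plus A x' * (1 + a * c' i)"
    using det_one_plus_resolvent[OF A(1) i nz(2)] by blast
  have "0 \<le> c i" by (rule resolvent_diag_nonneg[OF A(3) i x(1) c(1)])
  then show "det_one_plus A x \<le> det_one_plus A (x(i := x i + a))"
    unfolding c(2) using a pos(1) by simp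
  have "c' i \<le> c i" by (rule resolvent_diag_antimono[OF A(2,3) i x c(1) c'(1)])
  then show "det_one_plus A (x'(i := x' i + a)) * det_one_plus A x
      \<le> det_one_plus A x' * det_one_plus A (x(i := x i + a))"
    unfolding c(2) c'(2) using a pos by (simp add: mult_left_mono)
qed

lemma det_one_plus_cong:
  "A \<in> carrier_mat n n \<Longrightarrow> (\<And>j. j < n \<Longrightarrow> x j = x' j) \<Longrightarrow> det_one_plus A x = det_one_plus A x'"
  unfolding det_one_plus_def mat_diag_def
  by (intro arg_cong[where f = Determinant.det] arg_cong2[where f = "(+)"] arg_cong2[where f = "(*)"] refl)
    (auto intro!: eq_matI)

text \<open>The coordinates of \<open>x\<close> are switched on one at a time, starting from the
  determinant of the identity. The induction itself supplies the positivity that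
  \<open>det_one_plus_update\<close> requires.\<close>

lemma det_one_plus_ge_1:
  assumes psd: "symmetric_psd n A" and x: "\<And>j. j < n \<Longrightarrow> 0 \<le> x j"
  shows "1 \<le> det_one_plus A x"
proof -
  note A = symmetric_psdD(1)[OF psd]
  define r where "r k = (\<lambda>j. if j < k then x j else 0)" for k :: nat
  have "1 \<le> det_one_plus A (r k)" if "k \<le> n" for k
    using that
  proof (induction k)
    case 0
    have "1\<^sub>m n + A * mat_diag n (r 0) = 1\<^sub>m n"
      using A by (intro eq_matI) (auto simp: r_def mat_diag_mult_right[OF A])
    then show ?case using A by (simp add: det_one_plus_def)
  next
    case (Suc k)
    have "r (Suc k) = (r k)(k := r k k + x k)" by (auto simp: r_def fun_eq_iff less_Suc_eq)
    then have "det_one_plus A (r k) \<le> det_one_plus A (r (Suc k))"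
      using det_one_plus_update(1)[OF psd, of k "r k" "r k" "x k"] Suc x
      by (simp add: r_def)
    with Suc show ?case by simp
  qed
  from this[of n] show ?thesis
    using det_one_plus_cong[OF A, of "r n" x] by (simp add: r_def)
qed

text \<open>The coordinates of \<open>z\<close> are switched on one at a time. The ratio of the
  determinant at \<open>s k = x + r k\<close> to the one at \<open>r k\<close> never increases with
  \<open>k\<close>, since \<open>r k\<close> lies below \<open>s k\<close> and both receive the same
  increment.\<close>

lemma det_one_plus_submult:
  assumes psd: "symmetric_psd n A"
    and x: "\<And>j. j < n \<Longrightarrow> 0 \<le> x j" and z: "\<And>j. j < n \<Longrightarrow> 0 \<le> z j"
  shows "det_one_plus A (\<lambda>j. x j + z j) \<le> det_one_plus A x * det_one_plus A z"
proof -
  note A = symmetric_psdD(1)[OF psd]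
  define r where "r k = (\<lambda>j. if j < k then z j else 0)" for k :: nat
  define s where "s k = (\<lambda>j. x j + r k j)" for k :: nat
  have r0: "0 \<le> r k j" if "j < n" for k j using that z by (simp add: r_def)
  have ge: "1 \<le> det_one_plus A (r k)" "1 \<le> det_one_plus A (s k)" for k
    using x r0 by (auto intro!: det_one_plus_ge_1[OF psd] simp: s_def)
  have "det_one_plus A (s k) \<le> det_one_plus A x * det_one_plus A (r k)" if "k \<le> n" for k
    using that
  proof (induction k)
    case 0
    have "s 0 = x" by (auto simp: s_def r_def)
    moreover have "0 \<le> det_one_plus A x" using det_one_plus_ge_1[OF psd x] by fastforce
    ultimately show ?case using mult_left_mono[OF ge(1)[of 0]] by fastforce
  next
    case (Suc k)
    have r: "r (Suc k) = (r k)(k := r k k + z k)" and s: "s (Suc k) = (s k)(k := s k k + z k)"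
      by (auto simp: s_def r_def fun_eq_iff less_Suc_eq)
    have pos: "0 < det_one_plus A (r k)" "0 < det_one_plus A (s k)" "0 < det_one_plus A (r (Suc k))"
      using ge(1)[of k] ge(2)[of k] ge(1)[of "Suc k"] by linarith+
    have "det_one_plus A (s (Suc k)) * det_one_plus A (r k)
        \<le> det_one_plus A (s k) * det_one_plus A (r (Suc k))"
      unfolding r s by (rule det_one_plus_update(2)[OF psd]) (use Suc x z r0 pos in \<open>auto simp: s_def\<close>)
    also have "\<dots> \<le> det_one_plus A x * det_one_plus A (r k) * det_one_plus A (r (Suc k))"
      using Suc pos by (intro mult_right_mono) auto
    finally have "det_one_plus A (s (Suc k)) * det_one_plus A (r k)
        \<le> (det_one_plus A x * det_one_plus A (r (Suc k))) * det_one_plus A (r k)"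
      by (simp add: mult_ac)
    then show ?case using pos by simp
  qed
  from this[of n] show ?thesis
    using det_one_plus_cong[OF A, of "r n" z] det_one_plus_cong[OF A, of "s n" "\<lambda>j. x j + z j"]
    by (simp add: r_def s_def)
qed

text \<open>The index \<open>b j\<close> names the block containing row \<open>j\<close>. It is
  chosen before \<open>t\<close>, so that one and the same \<open>b\<close> serves for
  \<open>t\<close>, \<open>u\<close> and \<open>t + u\<close> when their determinants are
  compared.\<close>

lemma diag_block_mat_scaled_ones:
  "\<exists>b. (\<forall>j < sum_list (map p is). b j \<in> set is) \<and>
     (\<forall>t. diag_block_mat (map (\<lambda>i. t i \<cdot>\<^sub>m 1\<^sub>m (p i)) is)
        = mat_diag (sum_list (map p is)) (\<lambda>j. t (b j) :: real))"
proof (induction "is")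
  case Nil
  show ?case by (auto simp: mat_diag_def intro!: eq_matI)
next
  case (Cons i "is")
  then obtain b where b: "\<And>j. j < sum_list (map p is) \<Longrightarrow> b j \<in> set is"
    "\<And>t. diag_block_mat (map (\<lambda>i. t i \<cdot>\<^sub>m 1\<^sub>m (p i)) is)
        = mat_diag (sum_list (map p is)) (\<lambda>j. t (b j) :: real)" by blast
  define b' where "b' j = (if j < p i then i else b (j - p i))" for j
  show ?case
  proof (intro exI[of _ b'] conjI allI impI)
    show "b' j \<in> set (i # is)" if "j < sum_list (map p (i # is))" for j
      using that b(1)[of "j - p i"] by (auto simp: b'_def)
    show "diag_block_mat (map (\<lambda>i. t i \<cdot>\<^sub>m 1\<^sub>m (p i)) (i # is))
        = mat_diag (sum_list (map p (i # is))) (\<lambda>j. t (b' j))" for t :: "_ \<Rightarrow> real"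
      by (auto simp: Let_def b(2) mat_diag_def b'_def intro!: eq_matI)
  qed
qed

lemma trace_wishart_det:
  assumes psd: "symmetric_psd (\<Sum>i=1..d. p i) \<Sigma>"
  defines "D \<equiv> \<lambda>t. Determinant.det (1\<^sub>m (\<Sum>i=1..d. p i) + diag_blocks d p t * \<Sigma>)"
  shows trace_wishart_det_ge_1: "(\<And>i. i \<in> {1..d} \<Longrightarrow> 0 \<le> t i) \<Longrightarrow> 1 \<le> D t"
    and trace_wishart_det_submult: "(\<And>i. i \<in> {1..d} \<Longrightarrow> 0 \<le> t i) \<Longrightarrow>
      (\<And>i. i \<in> {1..d} \<Longrightarrow> 0 \<le> u i) \<Longrightarrow> D (\<lambda>i. t i + u i) \<le> D t * D u"
proof -
  have n: "(\<Sum>i=1..d. p i) = sum_list (map p [1..<d + 1])"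
    unfolding interv_sum_list_conv_sum_set_nat by (intro sum.cong) auto
  obtain b where b: "\<And>j. j < (\<Sum>i=1..d. p i) \<Longrightarrow> b j \<in> set [1..<d + 1]"
    and blocks: "\<And>t. diag_blocks d p t = mat_diag (\<Sum>i=1..d. p i) (\<lambda>j. t (b j))"
    using diag_block_mat_scaled_ones[of p "[1..<d + 1]", folded n diag_blocks_def] by blast
  have b: "b j \<in> {1..d}" if "j < (\<Sum>i=1..d. p i)" for j using b[OF that] by auto
  have D: "D t = det_one_plus \<Sigma> (\<lambda>j. t (b j))" for t
    unfolding D_def blocks by (rule det_one_plus_alt[OF psd])
  show "1 \<le> D t" if "\<And>i. i \<in> {1..d} \<Longrightarrow> 0 \<le> t i"
    unfolding D by (rule det_one_plus_ge_1[OF psd]) (use b that in blast)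
  show "D (\<lambda>i. t i + u i) \<le> D t * D u"
    if "\<And>i. i \<in> {1..d} \<Longrightarrow> 0 \<le> t i" "\<And>i. i \<in> {1..d} \<Longrightarrow> 0 \<le> u i"
    unfolding D by (rule det_one_plus_submult[OF psd]) (use b that in blast)+
qed

subsection \<open>Completely monotone functions\<close>

text \<open>In the intended use \<open>F k\<close> is the \<open>k\<close>-th derivative times
  \<open>(-1) ^ k\<close>, and \<open>y\<close> is the distance to the left of the centre
  \<open>c\<close>. The two signs cancel, so for \<open>y \<ge> 0\<close> all Taylor terms are
  nonnegative.\<close>

definition taylor_remainder :: "(nat \<Rightarrow> real \<Rightarrow> real) \<Rightarrow> real \<Rightarrow> nat \<Rightarrow> real \<Rightarrow> real" where
  "taylor_remainder F c n y = F 0 (c - y) - (\<Sum>k<n. F k c / fact k * y ^ k)"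

text \<open>Building the sign into \<open>F\<close> makes the class closed under shifting the index,
  which drives the inductions on the order of the remainder.\<close>

locale alternating_derivatives =
  fixes F :: "nat \<Rightarrow> real \<Rightarrow> real"
  assumes deriv: "\<And>n t. 0 < t \<Longrightarrow> (F n has_real_derivative - F (Suc n) t) (at t)"
    and nonneg: "\<And>n t. 0 < t \<Longrightarrow> 0 \<le> F n t"
begin

lemma shift: "alternating_derivatives (\<lambda>n. F (Suc n))"
  by unfold_locales (auto intro: deriv nonneg)

lemma taylor_remainder_Suc_0: "taylor_remainder F c (Suc n) 0 = 0"
  by (simp add: taylor_remainder_def lessThan_Suc_eq_insert_0 sum.reindex)

lemma taylor_remainder_deriv:
  assumes "y < c"
  shows "(taylor_remainder F c (Suc n) has_real_derivative
    taylor_remainder (\<lambda>n. F (Suc n)) c n y) (at y)"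
proof -
  have 1: "((\<lambda>y. F 0 (c - y)) has_real_derivative - F (Suc 0) (c - y) * (0 - 1)) (at y)"
    by (rule DERIV_chain2[OF deriv]) (use assms in \<open>auto intro!: derivative_eq_intros\<close>)
  have 2: "((\<lambda>y. \<Sum>k<Suc n. F k c / fact k * y ^ k) has_real_derivative
      (\<Sum>k<Suc n. F k c / fact k * (real k * y ^ (k - 1)))) (at y)"
    by (intro DERIV_sum DERIV_cmult) (auto intro!: derivative_eq_intros)
  \<comment> \<open>The term \<open>k = 0\<close> vanishes, and in the others
    \<open>Suc k / fact (Suc k)\<close> reduces to \<open>1 / fact k\<close>.\<close>
  have 3: "(\<Sum>k<Suc n. F k c / fact k * (real k * y ^ (k - 1)))
      = (\<Sum>k<n. F (Suc k) c / fact k * y ^ k)"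
    by (simp only: sum.lessThan_Suc_shift) (auto simp: divide_simps intro!: sum.cong)
  show ?thesis
    using DERIV_diff[OF 1 2[unfolded 3]] unfolding taylor_remainder_def by simp
qed

end

text \<open>Induction on the order: a remainder of positive order vanishes at 0, and its derivative
  is the remainder of one order less for the shifted family.\<close>

lemma taylor_remainder_nonneg:
  assumes "alternating_derivatives F" "0 \<le> y" "y < c"
  shows "0 \<le> taylor_remainder F c n y"
  using assms
proof (induction n arbitrary: F y)
  case 0
  then show ?case by (simp add: taylor_remainder_def alternating_derivatives.nonneg)
next
  case (Suc n)
  interpret alternating_derivatives F by fact
  have "taylor_remainder F c (Suc n) 0 \<le> taylor_remainder F c (Suc n) y"
  proof (rule DERIV_nonneg_imp_nondecreasing[where f = "taylor_remainder F c (Suc n)"])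
    fix z assume "0 \<le> z" "z \<le> y"
    with Suc.prems taylor_remainder_deriv[of z c n] Suc.IH[OF shift, of z]
    show "\<exists>D. (taylor_remainder F c (Suc n) has_real_derivative D) (at z) \<and> 0 \<le> D" by auto
  qed fact
  then show ?case by (simp add: taylor_remainder_Suc_0)
qed

text \<open>This is the source of geometric decay. Order 0 is monotonicity of \<open>F 0\<close>;
  for higher order the difference of the two sides vanishes at \<open>y = 0\<close> and its
  derivative is \<open>\<theta>\<close> times the difference one order lower.\<close>

lemma taylor_remainder_scale:
  assumes "alternating_derivatives F" "0 \<le> y" "y < c" "0 \<le> \<theta>" "\<theta> \<le> 1"
  shows "taylor_remainder F c n (\<theta> * y) \<le> \<theta> ^ n * taylor_remainder F c n y"
  using assms(1-3)
proof (induction n arbitrary: F y)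
  case 0
  interpret alternating_derivatives F by fact
  have "\<theta> * y \<le> y" using 0 assms(4,5) by (simp add: mult_left_le_one_le)
  then have "c - y \<le> c - \<theta> * y" by simp
  then have "F 0 (c - \<theta> * y) \<le> F 0 (c - y)"
  proof (rule DERIV_nonpos_imp_nonincreasing[where f = "F 0"])
    fix t assume "c - y \<le> t"
    with 0 have "0 < t" by simp
    then show "\<exists>D. (F 0 has_real_derivative D) (at t) \<and> D \<le> 0"
      using deriv[of t 0] nonneg[of t "Suc 0"] by auto
  qed
  then show ?case by (simp add: taylor_remainder_def)
next
  case (Suc n)
  interpret alternating_derivatives F by fact
  let ?R = "taylor_remainder F c (Suc n)" and ?R' = "taylor_remainder (\<lambda>n. F (Suc n)) c n"
  let ?K = "\<lambda>z. \<theta> ^ Suc n * ?R z - ?R (\<theta> * z)"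
  have "?K 0 \<le> ?K y"
  proof (rule DERIV_nonneg_imp_nondecreasing[where f = ?K])
    fix z assume z: "0 \<le> z" "z \<le> y"
    then have less: "z < c" "\<theta> * z < c"
      using Suc.prems mult_left_le_one_le[of z \<theta>] assms(4,5) by linarith+
    have "(?K has_real_derivative \<theta> ^ Suc n * ?R' z - ?R' (\<theta> * z) * \<theta>) (at z)"
      by (intro DERIV_diff DERIV_cmult taylor_remainder_deriv less
          DERIV_chain2[OF taylor_remainder_deriv]) (auto intro!: derivative_eq_intros)
    moreover have "0 \<le> \<theta> * (\<theta> ^ n * ?R' z - ?R' (\<theta> * z))"
      using Suc.IH[OF shift z(1) less(1)] assms(4) by simp
    ultimately show "\<exists>D. (?K has_real_derivative D) (at z) \<and> 0 \<le> D"
      by (auto simp: algebra_simps)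
  qed fact
  then show ?case by (simp add: taylor_remainder_Suc_0)
qed

text \<open>The remainder at \<open>y\<close> is compared with the one at a point \<open>y'\<close>
  strictly between \<open>y\<close> and \<open>c\<close>. The latter is at most
  \<open>F 0 (c - y')\<close>, so scaling by \<open>\<theta> = y / y' < 1\<close> gives a bound that
  tends to 0.\<close>

lemma (in alternating_derivatives) taylor_sums:
  assumes "0 \<le> y" "y < c"
  shows "(\<lambda>k. F k c / fact k * y ^ k) sums F 0 (c - y)"
proof -
  define y' where "y' = (y + c) / 2"
  define \<theta> where "\<theta> = y / y'"
  have y': "0 < y'" "y < y'" "y' < c" using assms by (auto simp: y'_def)
  have \<theta>: "0 \<le> \<theta>" "\<theta> < 1" "y = \<theta> * y'" using y' assms by (auto simp: \<theta>_def)
  have F: "alternating_derivatives F" by unfold_locales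
  have "(\<lambda>n. taylor_remainder F c n y) \<longlonglongrightarrow> 0"
  proof (rule tendsto_sandwich)
    show "\<forall>\<^sub>F n in sequentially. 0 \<le> taylor_remainder F c n y"
      using taylor_remainder_nonneg[OF F assms] by simp
    have "taylor_remainder F c n y \<le> \<theta> ^ n * F 0 (c - y')" for n
    proof -
      have "taylor_remainder F c n y \<le> \<theta> ^ n * taylor_remainder F c n y'"
        unfolding \<theta>(3) by (rule taylor_remainder_scale[OF F]) (use y' \<theta> in auto)
      also have "taylor_remainder F c n y' \<le> F 0 (c - y')"
        unfolding taylor_remainder_def using y' by (auto intro!: sum_nonneg simp: nonneg)
      finally show ?thesis using \<theta>(1) by (simp add: mult_left_mono)
    qed
    then show "\<forall>\<^sub>F n in sequentially. taylor_remainder F c n y \<le> \<theta> ^ n * F 0 (c - y')" by simp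
    show "(\<lambda>n. \<theta> ^ n * F 0 (c - y')) \<longlonglongrightarrow> 0"
      using \<theta> by (intro tendsto_mult_left_zero LIMSEQ_power_zero) simp
  qed simp
  then have "(\<lambda>n. F 0 (c - y) - taylor_remainder F c n y) \<longlonglongrightarrow> F 0 (c - y) - 0"
    by (intro tendsto_diff tendsto_const)
  then show ?thesis by (simp add: sums_def taylor_remainder_def)
qed

section \<open>Exponential series and increasing approximations of completely monotone
  functions\<close>

lemma completely_monotone_alternating:
  assumes "completely_monotone \<phi>"
  shows "alternating_derivatives (\<lambda>n t. (- 1) ^ n * (deriv ^^ n) \<phi> t)"
proof
  fix n :: nat and t :: real assume "0 < t"
  with assms have "(deriv ^^ n) \<phi> differentiable (at t)" "0 \<le> (- 1) ^ n * (deriv ^^ n) \<phi> t"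
    by (auto simp: completely_monotone_def)
  then show "((\<lambda>t. (- 1) ^ n * (deriv ^^ n) \<phi> t) has_real_derivative
      - ((- 1) ^ Suc n * (deriv ^^ Suc n) \<phi> t)) (at t)"
    and "0 \<le> (- 1) ^ n * (deriv ^^ n) \<phi> t"
    by (auto simp: DERIV_deriv_iff_real_differentiable intro!: derivative_eq_intros)
qed

lemma completely_monotone_props:
  assumes "completely_monotone \<phi>"
  shows completely_monotone_nonneg: "0 < t \<Longrightarrow> 0 \<le> \<phi> t"
    and completely_monotone_antimono: "0 < s \<Longrightarrow> s \<le> t \<Longrightarrow> \<phi> t \<le> \<phi> s"
    and completely_monotone_isCont: "0 < t \<Longrightarrow> isCont \<phi> t"
proof -
  interpret alternating_derivatives "\<lambda>n t. (- 1) ^ n * (deriv ^^ n) \<phi> t"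
    by (rule completely_monotone_alternating[OF assms])
  show "0 < t \<Longrightarrow> 0 \<le> \<phi> t" using nonneg[of t 0] by simp
  show "0 < t \<Longrightarrow> isCont \<phi> t" using deriv[of t 0] by (auto intro: DERIV_isCont)
  show "\<phi> t \<le> \<phi> s" if "0 < s" "s \<le> t"
    using that(2)
  proof (rule DERIV_nonpos_imp_nonincreasing)
    fix x assume "s \<le> x"
    with that have "0 < x" by simp
    then show "\<exists>y. (\<phi> has_real_derivative y) (at x) \<and> y \<le> 0"
      using deriv[of x 0] nonneg[of x "Suc 0"] by auto
  qed
qed

text \<open>Putting \<open>y = b * exp (- x / b)\<close> into \<open>taylor_sums\<close> turns the
  powers of \<open>y\<close> into exponentials in \<open>x\<close>. Positivity of
  \<open>\<epsilon>\<close> keeps \<open>y\<close> strictly below the centre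
  \<open>\<epsilon> + b\<close>, even at \<open>x = 0\<close>.\<close>

lemma completely_monotone_exp_series:
  assumes "completely_monotone \<phi>" "0 < \<epsilon>" "0 < b"
  obtains w where "\<And>k. 0 \<le> w k"
    and "\<And>x. 0 \<le> x \<Longrightarrow> (\<lambda>k. w k * exp (- (real k / b * x))) sums \<phi> (\<epsilon> + b * (1 - exp (- x / b)))"
proof -
  interpret alternating_derivatives "\<lambda>n t. (- 1) ^ n * (deriv ^^ n) \<phi> t"
    by (rule completely_monotone_alternating[OF assms(1)])
  define w where "w k = (- 1) ^ k * (deriv ^^ k) \<phi> (\<epsilon> + b) / fact k * b ^ k" for k
  show thesis
  proof (rule that)
    show "0 \<le> w k" for k
      unfolding w_def using assms nonneg[of "\<epsilon> + b" k] by simp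
    show "(\<lambda>k. w k * exp (- (real k / b * x))) sums \<phi> (\<epsilon> + b * (1 - exp (- x / b)))"
      if "0 \<le> x" for x
    proof -
      have "b * exp (- x / b) \<le> b * 1" using that assms by (intro mult_left_mono) auto
      then have "b * exp (- x / b) < \<epsilon> + b" using assms by linarith
      then have "(\<lambda>k. (- 1) ^ k * (deriv ^^ k) \<phi> (\<epsilon> + b) / fact k * (b * exp (- x / b)) ^ k) sums
          \<phi> (\<epsilon> + b - b * exp (- x / b))"
        using taylor_sums[of "b * exp (- x / b)" "\<epsilon> + b"] assms by simp
      moreover have "exp (- x / b) ^ k = exp (- (real k / b * x))" for k
        by (simp flip: exp_of_nat_mult)
      ultimately show ?thesis
        by (simp add: w_def power_mult_distrib mult.assoc algebra_simps)
    qed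
  qed
qed

text \<open>A function that may blow up at 0 becomes an increasing limit of bounded ones, ready for
  monotone convergence. Because of \<open>max 0 x\<close> this holds at negative \<open>x\<close>
  too, where both sides are the limit at 0.\<close>

lemma extend_to_zero_SUP:
  assumes "completely_monotone \<phi>"
  shows "extend_to_zero \<phi> x = (SUP n. ennreal (\<phi> (inverse (real (Suc n)) + max 0 x)))"
    and "incseq (\<lambda>n. ennreal (\<phi> (inverse (real (Suc n)) + max 0 x)))"
proof -
  have "inverse (real (Suc n)) \<le> inverse (real (Suc m))" if "m \<le> n" for m n
    using that by (simp add: divide_simps)
  then show inc: "incseq (\<lambda>n. ennreal (\<phi> (inverse (real (Suc n)) + max 0 x)))"
    by (intro incseq_def[THEN iffD2] allI impI ennreal_leI completely_monotone_antimono[OF assms])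
      (auto intro!: add_pos_nonneg)
  show "extend_to_zero \<phi> x = (SUP n. ennreal (\<phi> (inverse (real (Suc n)) + max 0 x)))"
  proof (cases "0 < x")
    case True
    have "(\<lambda>n. inverse (real (Suc n)) + max 0 x) \<longlonglongrightarrow> 0 + x"
      using True by (intro tendsto_add LIMSEQ_inverse_real_of_nat) simp
    then have "(\<lambda>n. ennreal (\<phi> (inverse (real (Suc n)) + max 0 x))) \<longlonglongrightarrow> ennreal (\<phi> x)"
      using completely_monotone_isCont[OF assms True]
      by (intro tendsto_ennrealI isCont_tendsto_compose[of x \<phi>]) simp_all
    then show ?thesis
      using LIMSEQ_SUP[OF inc] LIMSEQ_unique True by (auto simp: extend_to_zero_def)
  next
    case False
    let ?L = "SUP n. ennreal (\<phi> (inverse (real (Suc n))))"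
    have "((\<lambda>t. ennreal (\<phi> t)) \<longlongrightarrow> ?L) (at_right 0)"
    proof (rule order_tendstoI)
      fix a assume "a < ?L"
      then obtain n where n: "a < ennreal (\<phi> (inverse (real (Suc n))))"
        by (auto simp: less_SUP_iff)
      have "\<forall>\<^sub>F t in at_right 0. 0 < t \<and> t < inverse (real (Suc n))"
        by (auto simp: eventually_at_right_field intro!: exI[of _ "inverse (real (Suc n))"])
      then show "\<forall>\<^sub>F t in at_right 0. a < ennreal (\<phi> t)"
        by eventually_elim
          (use n in \<open>auto elim!: less_le_trans intro!: ennreal_leI completely_monotone_antimono[OF assms]\<close>)
    next
      fix a assume a: "?L < a"
      have "\<forall>\<^sub>F t in at_right 0. 0 < (t :: real)" by (simp add: eventually_at_right_less)
      then show "\<forall>\<^sub>F t in at_right 0. ennreal (\<phi> t) < a"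
      proof eventually_elim
        case (elim t)
        then obtain n where n: "inverse (real (Suc n)) < t" using reals_Archimedean by blast
        have "ennreal (\<phi> t) \<le> ennreal (\<phi> (inverse (real (Suc n))))"
          using n by (intro ennreal_leI completely_monotone_antimono[OF assms]) auto
        also have "\<dots> \<le> ?L" by (rule SUP_upper) simp
        finally show ?case using a by simp
      qed
    qed
    then have "Lim (at_right 0) (\<lambda>t. ennreal (\<phi> t)) = ?L" by (intro tendsto_Lim) simp_all
    with False show ?thesis by (simp add: extend_to_zero_def max_def)
  qed
qed

subsection \<open>Passing from exponentials to completely monotone functions\<close>

text \<open>Induction on the set \<open>L\<close> of coordinates allowed to leave \<open>A\<close>.
  When coordinate \<open>i\<close> is treated, the others may lie in either class, and the claim is
  known for every replacement of \<open>h i\<close> by a member of \<open>A i\<close>.\<close>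

lemma coordinatewise_induct:
  assumes "finite K"
    and base: "\<And>h. (\<And>i. i \<in> K \<Longrightarrow> h i \<in> A i) \<Longrightarrow> P h"
    and step: "\<And>h i. i \<in> K \<Longrightarrow> (\<And>j. j \<in> K \<Longrightarrow> h j \<in> A j \<union> B j) \<Longrightarrow> h i \<in> B i \<Longrightarrow>
      (\<And>a. a \<in> A i \<Longrightarrow> P (h(i := a))) \<Longrightarrow> P h"
    and "\<And>i. i \<in> K \<Longrightarrow> h i \<in> A i \<union> B i"
  shows "P h"
proof -
  have "P h" if "finite L" "L \<subseteq> K" "\<And>i. i \<in> L \<Longrightarrow> h i \<in> A i \<union> B i"
    "\<And>i. i \<in> K - L \<Longrightarrow> h i \<in> A i" for L h
    using that
  proof (induction L arbitrary: h rule: finite_induct)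
    case empty
    then show ?case by (intro base) auto
  next
    case (insert i L)
    have IH: "P (h(i := a))" if "a \<in> A i" for a
      using insert.prems insert.hyps that by (intro insert.IH) auto
    show ?case
    proof (cases "h i \<in> A i")
      case True
      then show ?thesis using IH[of "h i"] by simp
    next
      case False
      have "i \<in> K" using insert.prems by simp
      then show ?thesis
      proof (rule step[of i h])
        show "h j \<in> A j \<union> B j" if "j \<in> K" for j
          using insert.prems(2)[of j] insert.prems(3)[of j] that by blast
        show "h i \<in> B i" using insert.prems(2)[of i] False by simp
      qed (rule IH)
    qed
  qed
  from this[OF \<open>finite K\<close> order.refl assms(4)] show ?thesis by simp
qed

text \<open>Where \<open>Z\<close> is negative the integrands tend to infinity. By Fatou's lemma
  their lower limit has finite integral, so this happens only on a null set.\<close>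

lemma AE_nonneg_of_laplace_bounded:
  assumes [measurable]: "Z \<in> borel_measurable M"
    and le: "\<And>n::nat. (\<integral>\<^sup>+\<omega>. ennreal (exp (- (real n * Z \<omega>))) \<partial>M) \<le> ennreal C"
  shows "AE \<omega> in M. 0 \<le> Z \<omega>"
proof -
  let ?f = "\<lambda>\<omega>. liminf (\<lambda>n::nat. ennreal (exp (- (real n * Z \<omega>))))"
  have "(\<integral>\<^sup>+\<omega>. ?f \<omega> \<partial>M) \<le> liminf (\<lambda>n::nat. \<integral>\<^sup>+\<omega>. ennreal (exp (- (real n * Z \<omega>))) \<partial>M)"
    by (intro nn_integral_liminf) measurable
  also have "\<dots> \<le> liminf (\<lambda>n::nat. ennreal C)"
    by (intro Liminf_mono always_eventually allI le)
  also have "\<dots> = ennreal C" by (simp add: Liminf_const)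
  finally have "(\<integral>\<^sup>+\<omega>. ?f \<omega> \<partial>M) \<noteq> \<infinity>" by (auto simp: top_unique)
  then have "AE \<omega> in M. ?f \<omega> \<noteq> \<infinity>" by (intro nn_integral_PInf_AE) measurable
  then show ?thesis
  proof eventually_elim
    case (elim \<omega>)
    show ?case
    proof (rule ccontr)
      assume "\<not> 0 \<le> Z \<omega>"
      then have "filterlim (\<lambda>n::nat. - Z \<omega> * real n) at_top sequentially"
        by (intro filterlim_tendsto_pos_mult_at_top[OF tendsto_const] filterlim_real_sequentially) simp
      then have "filterlim (\<lambda>n::nat. exp (- (real n * Z \<omega>))) at_top sequentially"
        using filterlim_compose[OF exp_at_top] by (simp add: mult.commute)
      then have "(\<lambda>n::nat. ennreal (exp (- (real n * Z \<omega>)))) \<longlonglongrightarrow> \<infinity>"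
        by (simp add: ennreal_tendsto_top_eq_at_top)
      then have "?f \<omega> = \<infinity>" by (intro lim_imp_Liminf) simp_all
      with elim show False by simp
    qed
  qed
qed

section \<open>Moments of products and their correlation inequality\<close>

definition prod_moment :: "'a measure \<Rightarrow> (nat \<Rightarrow> 'a \<Rightarrow> real) \<Rightarrow> nat set \<Rightarrow> (nat \<Rightarrow> real \<Rightarrow> ennreal) \<Rightarrow> ennreal"
  where "prod_moment M Y K h = (\<integral>\<^sup>+\<omega>. (\<Prod>i\<in>K. h i (Y i \<omega>)) \<partial>M)"

text \<open>Extended nonnegative integrals keep the inequality meaningful for unbounded factors and
  stable under increasing limits.\<close>

definition pos_correlated ::
  "'a measure \<Rightarrow> (nat \<Rightarrow> 'a \<Rightarrow> real) \<Rightarrow> nat set \<Rightarrow> nat set \<Rightarrow> (nat \<Rightarrow> real \<Rightarrow> ennreal) \<Rightarrow> bool"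
  where "pos_correlated M Y I J h \<longleftrightarrow>
    prod_moment M Y I h * prod_moment M Y J h \<le> prod_moment M Y (I \<union> J) h"

lemma pos_correlated_sym: "pos_correlated M Y I J h \<longleftrightarrow> pos_correlated M Y J I h"
  by (simp add: pos_correlated_def mult.commute Un_commute)

text \<open>This is what multiplies \<open>h i\<close> under the integral; it stays fixed while
  coordinate \<open>i\<close> is approximated.\<close>

definition cofactor_prod ::
  "(nat \<Rightarrow> 'a \<Rightarrow> real) \<Rightarrow> nat set \<Rightarrow> (nat \<Rightarrow> real \<Rightarrow> ennreal) \<Rightarrow> nat \<Rightarrow> 'a \<Rightarrow> ennreal"
  where "cofactor_prod Y K h i \<omega> = (\<Prod>j\<in>K - {i}. h j (Y j \<omega>))"

lemma prod_moment_upd: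
  assumes "finite K"
  shows "i \<in> K \<Longrightarrow> prod_moment M Y K (h(i := g)) = (\<integral>\<^sup>+\<omega>. g (Y i \<omega>) * cofactor_prod Y K h i \<omega> \<partial>M)"
    and "i \<notin> K \<Longrightarrow> prod_moment M Y K (h(i := g)) = prod_moment M Y K h"
proof -
  show "prod_moment M Y K (h(i := g)) = (\<integral>\<^sup>+\<omega>. g (Y i \<omega>) * cofactor_prod Y K h i \<omega> \<partial>M)" if "i \<in> K"
    unfolding prod_moment_def cofactor_prod_def
    by (intro nn_integral_cong, subst prod.remove[OF assms that])
      (auto intro!: arg_cong2[where f = "(*)"] prod.cong)
  show "prod_moment M Y K (h(i := g)) = prod_moment M Y K h" if "i \<notin> K"
    unfolding prod_moment_def using that by (auto intro!: nn_integral_cong prod.cong)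
qed

text \<open>As \<open>i\<close> lies outside \<open>J\<close>, the moment over \<open>J\<close> does
  not see \<open>g\<close>. Both sides are therefore linear in \<open>g\<close>, which lets the
  inequality pass to nonnegative series and to limits.\<close>

lemma pos_correlated_upd:
  assumes "finite I" "finite J" "I \<inter> J = {}" "i \<in> I"
  shows "pos_correlated M Y I J (h(i := g)) \<longleftrightarrow>
    (\<integral>\<^sup>+\<omega>. g (Y i \<omega>) * cofactor_prod Y I h i \<omega> \<partial>M) * prod_moment M Y J h
      \<le> (\<integral>\<^sup>+\<omega>. g (Y i \<omega>) * cofactor_prod Y (I \<union> J) h i \<omega> \<partial>M)"
proof -
  have "i \<notin> J" "i \<in> I \<union> J" "finite (I \<union> J)" using assms by auto
  with assms show ?thesis by (simp add: pos_correlated_def prod_moment_upd)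
qed

definition bounded_test :: "(real \<Rightarrow> ennreal) set" where
  "bounded_test = {h \<in> borel_measurable borel. \<exists>C. \<forall>x. h x \<le> ennreal C}"

lemma cofactor_prod_measurable:
  assumes "\<And>j. j \<in> K \<Longrightarrow> Y j \<in> borel_measurable M" "\<And>j. j \<in> K \<Longrightarrow> h j \<in> borel_measurable borel"
  shows "cofactor_prod Y K h i \<in> borel_measurable M"
  unfolding cofactor_prod_def[abs_def]
  by (intro borel_measurable_prod_ennreal measurable_compose[OF assms]) auto

lemma (in finite_measure) prod_bounded_test_finite:
  assumes "finite K" "\<And>j. j \<in> K \<Longrightarrow> h j \<in> bounded_test"
  shows "(\<integral>\<^sup>+\<omega>. (\<Prod>j\<in>K. h j (Y j \<omega>)) \<partial>M) < \<infinity>"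
proof -
  obtain C where C: "\<And>j x. j \<in> K \<Longrightarrow> h j x \<le> ennreal (C j)"
    using assms(2) unfolding bounded_test_def mem_Collect_eq by metis
  \<comment> \<open>A bound \<open>C j\<close> may be negative, in which case \<open>ennreal\<close>
    sends it to 0; \<open>max 0\<close> makes \<open>prod_ennreal\<close> applicable.\<close>
  have "(\<integral>\<^sup>+\<omega>. (\<Prod>j\<in>K. h j (Y j \<omega>)) \<partial>M) \<le> (\<integral>\<^sup>+\<omega>. (\<Prod>j\<in>K. ennreal (max 0 (C j))) \<partial>M)"
    by (intro nn_integral_mono prod_mono_ennreal order.trans[OF C] ennreal_leI) auto
  also have "\<dots> = ennreal (\<Prod>j\<in>K. max 0 (C j)) * emeasure M (space M)"
    by (subst prod_ennreal) auto
  also have "\<dots> < \<infinity>" by (simp add: ennreal_mult_eq_top_iff less_top[symmetric])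
  finally show ?thesis .
qed

text \<open>The shift by \<open>\<epsilon>\<close> keeps all factors bounded, so that dominated convergence applies.\<close>

lemma (in finite_measure) pos_correlated_shifted_step:
  assumes IJ: "finite I" "finite J" "I \<inter> J = {}" "i \<in> I"
    and Y: "\<And>j. j \<in> I \<union> J \<Longrightarrow> Y j \<in> borel_measurable M"
    and h: "\<And>j. j \<in> I \<union> J \<Longrightarrow> h j \<in> bounded_test"
    and cm: "completely_monotone \<phi>" and \<epsilon>: "0 < \<epsilon>"
    and exps: "\<And>s. 0 \<le> s \<Longrightarrow> pos_correlated M Y I J (h(i := \<lambda>x. ennreal (exp (- (s * max 0 x)))))"
  shows "pos_correlated M Y I J (h(i := \<lambda>x. ennreal (\<phi> (\<epsilon> + max 0 x))))"
proof -
  define P Q where "P = cofactor_prod Y I h i" and "Q = cofactor_prod Y (I \<union> J) h i"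
  define c where "c = prod_moment M Y J h"
  define y where "y \<omega> = max 0 (Y i \<omega>)" for \<omega>
  note upd = pos_correlated_upd[OF IJ, of M Y h, folded P_def Q_def c_def]
  have [measurable]: "Y i \<in> borel_measurable M" using Y IJ by auto
  have y[measurable]: "y \<in> borel_measurable M" and y0: "\<And>\<omega>. 0 \<le> y \<omega>" unfolding y_def by auto
  have [measurable]: "P \<in> borel_measurable M" "Q \<in> borel_measurable M"
    unfolding P_def Q_def using Y h by (auto intro!: cofactor_prod_measurable simp: bounded_test_def)
  have fin: "(\<integral>\<^sup>+\<omega>. P \<omega> \<partial>M) < \<infinity>" "(\<integral>\<^sup>+\<omega>. Q \<omega> \<partial>M) < \<infinity>" "c < \<infinity>"
    unfolding P_def Q_def c_def cofactor_prod_def prod_moment_def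
    using IJ h by (auto intro!: prod_bounded_test_finite simp del: infinity_ennreal_def)
  have exps': "(\<integral>\<^sup>+\<omega>. ennreal (exp (- (s * y \<omega>))) * P \<omega> \<partial>M) * c
      \<le> (\<integral>\<^sup>+\<omega>. ennreal (exp (- (s * y \<omega>))) * Q \<omega> \<partial>M)" if "0 \<le> s" for s
    using exps[OF that] unfolding upd y_def .
  \<comment> \<open>The approximation of \<open>completely_monotone_exp_series\<close> with
    \<open>b = Suc n\<close>, which is positive for \<open>n = 0\<close> as well.\<close>
  define \<psi> where "\<psi> n x = \<phi> (\<epsilon> + real (Suc n) * (1 - exp (- x / real (Suc n))))" for n x
  have arg0: "0 \<le> real (Suc n) * (1 - exp (- x / real (Suc n)))" if "0 \<le> x" for n x
    using that by (intro mult_nonneg_nonneg) auto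
  \<comment> \<open>\<open>\<phi>\<close> is controlled only at positive arguments, so measurability
    goes through continuity on the closed half-line containing the values of
    \<open>y\<close>.\<close>
  have cont: "continuous_on {0..} (\<lambda>x. \<phi> (\<epsilon> + f x))"
    if "continuous_on {0..} f" "\<And>x. 0 \<le> x \<Longrightarrow> 0 \<le> f x" for f :: "real \<Rightarrow> real"
  proof (rule continuous_on_compose2[of "{0<..}" \<phi>])
    show "continuous_on {0<..} \<phi>"
      using completely_monotone_isCont[OF cm] by (auto intro: continuous_at_imp_continuous_on)
    show "(\<lambda>x. \<epsilon> + f x) ` {0..} \<subseteq> {0<..}" using that(2) \<epsilon> by (auto intro: add_pos_nonneg)
  qed (intro continuous_intros that)
  have y_meas: "y \<in> measurable M (restrict_space borel {0..})"
    using y y0 by (auto intro!: measurable_restrict_space2)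
  have \<psi>_meas[measurable]: "(\<lambda>\<omega>. \<psi> n (y \<omega>)) \<in> borel_measurable M" for n
    unfolding \<psi>_def
    by (rule measurable_compose[OF y_meas borel_measurable_continuous_on_restrict[OF cont]])
      (auto intro!: continuous_intros arg0 simp del: of_nat_Suc)
  have \<phi>_meas[measurable]: "(\<lambda>\<omega>. \<phi> (\<epsilon> + y \<omega>)) \<in> borel_measurable M"
    by (rule measurable_compose[OF y_meas borel_measurable_continuous_on_restrict[OF cont]])
      (auto intro!: continuous_intros)
  \<comment> \<open>Expand \<open>\<psi> n\<close> as a series of exponentials with nonnegative
    weights and sum the inequalities for the rates \<open>k / Suc n\<close>.\<close>
  have \<psi>: "(\<integral>\<^sup>+\<omega>. ennreal (\<psi> n (y \<omega>)) * P \<omega> \<partial>M) * c \<le> (\<integral>\<^sup>+\<omega>. ennreal (\<psi> n (y \<omega>)) * Q \<omega> \<partial>M)" for n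
  proof -
    obtain w where w: "\<And>k. 0 \<le> w k"
      "\<And>x. 0 \<le> x \<Longrightarrow> (\<lambda>k. w k * exp (- (real k / real (Suc n) * x))) sums \<psi> n x"
      unfolding \<psi>_def by (rule completely_monotone_exp_series[OF cm \<epsilon>, of "real (Suc n)"]) auto
    define e where "e k x = ennreal (exp (- (real k / real (Suc n) * x)))" for k x
    have [measurable]: "(\<lambda>\<omega>. e k (y \<omega>)) \<in> borel_measurable M" for k unfolding e_def by measurable
    have "ennreal (\<psi> n (y \<omega>)) = (\<Sum>k. ennreal (w k) * e k (y \<omega>))" for \<omega>
      using suminf_ennreal_eq[OF _ w(2)[OF y0]] w(1) by (simp add: e_def ennreal_mult)
    then have series: "(\<integral>\<^sup>+\<omega>. ennreal (\<psi> n (y \<omega>)) * R \<omega> \<partial>M)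
        = (\<Sum>k. ennreal (w k) * (\<integral>\<^sup>+\<omega>. e k (y \<omega>) * R \<omega> \<partial>M))"
      if [measurable]: "R \<in> borel_measurable M" for R
      by (simp add: nn_integral_suminf[symmetric] nn_integral_cmult[symmetric] mult.assoc
          flip: ennreal_suminf_multc)
    have "(\<integral>\<^sup>+\<omega>. ennreal (\<psi> n (y \<omega>)) * P \<omega> \<partial>M) * c
        = (\<Sum>k. ennreal (w k) * ((\<integral>\<^sup>+\<omega>. e k (y \<omega>) * P \<omega> \<partial>M) * c))"
      by (simp add: series mult.assoc flip: ennreal_suminf_multc)
    also have "\<dots> \<le> (\<Sum>k. ennreal (w k) * (\<integral>\<^sup>+\<omega>. e k (y \<omega>) * Q \<omega> \<partial>M))"
      unfolding e_def by (intro suminf_le mult_left_mono exps') auto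
    also have "\<dots> = (\<integral>\<^sup>+\<omega>. ennreal (\<psi> n (y \<omega>)) * Q \<omega> \<partial>M)" by (simp add: series)
    finally show ?thesis .
  qed
  have lim: "(\<lambda>n. \<integral>\<^sup>+\<omega>. ennreal (\<psi> n (y \<omega>)) * R \<omega> \<partial>M)
      \<longlonglongrightarrow> (\<integral>\<^sup>+\<omega>. ennreal (\<phi> (\<epsilon> + y \<omega>)) * R \<omega> \<partial>M)"
    if [measurable]: "R \<in> borel_measurable M" and R: "(\<integral>\<^sup>+\<omega>. R \<omega> \<partial>M) < \<infinity>" "\<And>\<omega>. R \<omega> < \<infinity>" for R
  proof (rule nn_integral_dominated_convergence[where w = "\<lambda>\<omega>. ennreal (\<phi> \<epsilon>) * R \<omega>"])
    show "(\<integral>\<^sup>+\<omega>. ennreal (\<phi> \<epsilon>) * R \<omega> \<partial>M) < \<infinity>"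
      using R(1) by (simp add: nn_integral_cmult ennreal_mult_less_top)
    \<comment> \<open>The argument of \<open>\<phi>\<close> never falls below
      \<open>\<epsilon>\<close>, so \<open>\<phi> \<epsilon>\<close> dominates by
      monotonicity.\<close>
    show "AE \<omega> in M. ennreal (\<psi> n (y \<omega>)) * R \<omega> \<le> ennreal (\<phi> \<epsilon>) * R \<omega>" for n
      unfolding \<psi>_def using arg0[OF y0] \<epsilon>
      by (intro AE_I2 mult_right_mono ennreal_leI completely_monotone_antimono[OF cm]) (auto simp del: of_nat_Suc)
    have "(\<lambda>n. real (Suc n) * (1 - exp (- x / real (Suc n)))) \<longlonglongrightarrow> x" if "0 \<le> x" for x
      using that by (cases "x = 0") (simp, real_asymp)
    from this[OF y0] have "(\<lambda>n. \<psi> n (y \<omega>)) \<longlonglongrightarrow> \<phi> (\<epsilon> + y \<omega>)" for \<omega>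
      unfolding \<psi>_def using completely_monotone_isCont[OF cm, of "\<epsilon> + y \<omega>"] y0[of \<omega>] \<epsilon>
      by (intro isCont_tendsto_compose[of "\<epsilon> + y \<omega>" \<phi>] tendsto_add tendsto_const) auto
    then show "AE \<omega> in M. (\<lambda>n. ennreal (\<psi> n (y \<omega>)) * R \<omega>) \<longlonglongrightarrow> ennreal (\<phi> (\<epsilon> + y \<omega>)) * R \<omega>"
      using R(2)[THEN less_imp_neq] by (intro AE_I2 tendsto_mult_ennreal tendsto_ennrealI tendsto_const) auto
  qed measurable
  \<comment> \<open>Finite pointwise values exclude products of 0 and infinity, where multiplication
    in \<open>ennreal\<close> is discontinuous.\<close>
  have PQ: "P \<omega> < \<infinity>" "Q \<omega> < \<infinity>" for \<omega>
  proof -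
    have "h j x < \<infinity>" if "j \<in> I \<union> J" for j x
      using h[OF that] by (auto simp: bounded_test_def intro: le_less_trans)
    then show "P \<omega> < \<infinity>" "Q \<omega> < \<infinity>"
      unfolding P_def Q_def cofactor_prod_def by (auto simp: less_top[symmetric] ennreal_prod_eq_top)
  qed
  have "(\<lambda>n. (\<integral>\<^sup>+\<omega>. ennreal (\<psi> n (y \<omega>)) * P \<omega> \<partial>M) * c)
      \<longlonglongrightarrow> (\<integral>\<^sup>+\<omega>. ennreal (\<phi> (\<epsilon> + y \<omega>)) * P \<omega> \<partial>M) * c"
    using fin(3) by (subst (1 2) mult.commute) (intro ennreal_tendsto_cmult lim fin PQ; simp)
  then have "(\<integral>\<^sup>+\<omega>. ennreal (\<phi> (\<epsilon> + y \<omega>)) * P \<omega> \<partial>M) * c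
      \<le> (\<integral>\<^sup>+\<omega>. ennreal (\<phi> (\<epsilon> + y \<omega>)) * Q \<omega> \<partial>M)"
    by (rule LIMSEQ_le[OF _ lim]) (use \<psi> fin PQ in auto)
  then show ?thesis unfolding upd y_def .
qed

text \<open>Monotone convergence on both sides: integration and multiplication by a fixed factor
  commute with increasing suprema in \<open>ennreal\<close>.\<close>

lemma pos_correlated_SUP_step:
  assumes IJ: "finite I" "finite J" "I \<inter> J = {}" "i \<in> I"
    and Y: "\<And>j. j \<in> I \<union> J \<Longrightarrow> Y j \<in> borel_measurable M"
    and h: "\<And>j. j \<in> I \<union> J \<Longrightarrow> h j \<in> borel_measurable borel"
    and g: "\<And>n. g n \<in> borel_measurable borel" "\<And>x. incseq (\<lambda>n. g n x)"
    and corr: "\<And>n. pos_correlated M Y I J (h(i := g n))"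
  shows "pos_correlated M Y I J (h(i := \<lambda>x. SUP n. g n x))"
proof -
  define P Q where "P = cofactor_prod Y I h i" and "Q = cofactor_prod Y (I \<union> J) h i"
  define c where "c = prod_moment M Y J h"
  note upd = pos_correlated_upd[OF IJ, of M Y h, folded P_def Q_def c_def]
  have Yi: "Y i \<in> borel_measurable M" using Y IJ by auto
  have [measurable]: "(\<lambda>\<omega>. g n (Y i \<omega>)) \<in> borel_measurable M" for n
    by (rule measurable_compose[OF Yi g(1)])
  have [measurable]: "P \<in> borel_measurable M" "Q \<in> borel_measurable M"
    unfolding P_def Q_def using Y h by (auto intro!: cofactor_prod_measurable)
  have SUP: "(\<integral>\<^sup>+\<omega>. (SUP n. g n (Y i \<omega>)) * R \<omega> \<partial>M) = (SUP n. \<integral>\<^sup>+\<omega>. g n (Y i \<omega>) * R \<omega> \<partial>M)"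
    if [measurable]: "R \<in> borel_measurable M" for R
  proof -
    have "incseq (\<lambda>n \<omega>. g n (Y i \<omega>) * R \<omega>)"
      using g(2) by (auto simp: incseq_def le_fun_def mult_right_mono)
    then have "(\<integral>\<^sup>+\<omega>. (SUP n. g n (Y i \<omega>) * R \<omega>) \<partial>M) = (SUP n. \<integral>\<^sup>+\<omega>. g n (Y i \<omega>) * R \<omega> \<partial>M)"
      by (rule nn_integral_monotone_convergence_SUP) measurable
    then show ?thesis by (simp only: SUP_mult_right_ennreal)
  qed
  have "(SUP n. \<integral>\<^sup>+\<omega>. g n (Y i \<omega>) * P \<omega> \<partial>M) * c = (SUP n. (\<integral>\<^sup>+\<omega>. g n (Y i \<omega>) * P \<omega> \<partial>M) * c)"
    by (simp only: SUP_mult_right_ennreal)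
  also have "\<dots> \<le> (SUP n. \<integral>\<^sup>+\<omega>. g n (Y i \<omega>) * Q \<omega> \<partial>M)"
    by (rule SUP_mono) (use corr[unfolded upd] in blast)
  finally show ?thesis by (simp only: upd SUP[of P] SUP[of Q] \<open>P \<in> borel_measurable M\<close> \<open>Q \<in> borel_measurable M\<close>)
qed

lemma pos_correlated_cong:
  assumes "\<And>i. i \<in> I \<union> J \<Longrightarrow> h i = h' i"
  shows "pos_correlated M Y I J h \<longleftrightarrow> pos_correlated M Y I J h'"
  using assms by (simp add: pos_correlated_def prod_moment_def)

lemma exp_bounded_test: "0 \<le> s \<Longrightarrow> (\<lambda>x. ennreal (exp (- (s * max 0 x)))) \<in> bounded_test"
  unfolding bounded_test_def by (auto intro!: exI[of _ 1] ennreal_leI simp flip: ennreal_1)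

lemma shifted_bounded_test:
  assumes "completely_monotone \<phi>" "0 < \<epsilon>"
  shows "(\<lambda>x. ennreal (\<phi> (\<epsilon> + max 0 x))) \<in> bounded_test"
proof -
  have "continuous_on UNIV (\<lambda>x. \<phi> (\<epsilon> + max 0 x))"
  proof (rule continuous_on_compose2[of "{0<..}" \<phi>])
    show "continuous_on {0<..} \<phi>"
      using completely_monotone_isCont[OF assms(1)] by (auto intro: continuous_at_imp_continuous_on)
  qed (use assms(2) in \<open>auto intro!: continuous_intros add_pos_nonneg\<close>)
  then have "(\<lambda>x. \<phi> (\<epsilon> + max 0 x)) \<in> borel_measurable borel"
    by (rule borel_measurable_continuous_onI)
  moreover have "ennreal (\<phi> (\<epsilon> + max 0 x)) \<le> ennreal (\<phi> \<epsilon>)" for x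
    using assms(2) by (intro ennreal_leI completely_monotone_antimono[OF assms(1)]) auto
  ultimately show ?thesis unfolding bounded_test_def by auto
qed

text \<open>There are two passes over the coordinates: from exponentials to shifted functions by
  dominated convergence, then to \<open>extend_to_zero\<close> by monotone convergence. They are
  kept apart because the first asks for bounded factors in all coordinates, whereas the final
  functions may be unbounded near 0.\<close>

lemma (in finite_measure) pos_correlated_completely_monotone:
  assumes IJ: "finite I" "finite J" "I \<inter> J = {}"
    and Y: "\<And>j. j \<in> I \<union> J \<Longrightarrow> Y j \<in> borel_measurable M"
    and cm: "\<And>j. j \<in> I \<union> J \<Longrightarrow> completely_monotone (\<phi> j)"
    and exps: "\<And>t. (\<And>j. j \<in> I \<union> J \<Longrightarrow> 0 \<le> t j) \<Longrightarrow>
      pos_correlated M Y I J (\<lambda>j x. ennreal (exp (- (t j * max 0 x))))"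
  shows "pos_correlated M Y I J (\<lambda>j. extend_to_zero (\<phi> j))"
proof -
  define E :: "(real \<Rightarrow> ennreal) set"
    where "E = {\<lambda>x. ennreal (exp (- (s * max 0 x))) | s. 0 \<le> s}"
  define S where "S j = {\<lambda>x. ennreal (\<phi> j (\<epsilon> + max 0 x)) | \<epsilon>. 0 < \<epsilon>}" for j
  have fin: "finite (I \<union> J)" and JI: "J \<inter> I = {}" using IJ by auto
  have bounded: "g \<in> bounded_test" if "j \<in> I \<union> J" "g \<in> E \<union> S j" for g j
    using that cm exp_bounded_test shifted_bounded_test by (auto simp: E_def S_def)
  have shifted: "pos_correlated M Y I J h" if h: "\<And>j. j \<in> I \<union> J \<Longrightarrow> h j \<in> E \<union> S j" for h
  proof (rule coordinatewise_induct[OF fin _ _ h, where P = "pos_correlated M Y I J"])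
    fix h assume "\<And>j. j \<in> I \<union> J \<Longrightarrow> h j \<in> E"
    then have "\<forall>j\<in>I \<union> J. \<exists>s. 0 \<le> s \<and> h j = (\<lambda>x. ennreal (exp (- (s * max 0 x))))"
      unfolding E_def by blast
    then obtain t where t: "\<And>j. j \<in> I \<union> J \<Longrightarrow> 0 \<le> t j"
      "\<And>j. j \<in> I \<union> J \<Longrightarrow> h j = (\<lambda>x. ennreal (exp (- (t j * max 0 x))))"
      by metis
    have "pos_correlated M Y I J h \<longleftrightarrow>
        pos_correlated M Y I J (\<lambda>j x. ennreal (exp (- (t j * max 0 x))))"
      by (rule pos_correlated_cong) (rule t(2))
    also have \<dots> by (rule exps) (rule t(1))
    finally show "pos_correlated M Y I J h" .
  next
    fix h i assume i: "i \<in> I \<union> J" and h: "\<And>j. j \<in> I \<union> J \<Longrightarrow> h j \<in> E \<union> S j" and "h i \<in> S i"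
      and E: "\<And>g. g \<in> E \<Longrightarrow> pos_correlated M Y I J (h(i := g))"
    then obtain \<epsilon> where \<epsilon>: "0 < \<epsilon>" and hi: "h i = (\<lambda>x. ennreal (\<phi> i (\<epsilon> + max 0 x)))"
      unfolding S_def by blast
    have b: "h j \<in> bounded_test" if "j \<in> I \<union> J" for j using bounded h that by blast
    have e: "pos_correlated M Y I J (h(i := \<lambda>x. ennreal (exp (- (s * max 0 x)))))" if "0 \<le> s" for s
      by (rule E) (use that in \<open>auto simp: E_def\<close>)
    from i have "pos_correlated M Y I J (h(i := \<lambda>x. ennreal (\<phi> i (\<epsilon> + max 0 x))))"
    proof
      assume "i \<in> I"
      then show ?thesis
        by (rule pos_correlated_shifted_step[OF IJ _ Y b cm[OF i] \<epsilon> e])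
    next
      \<comment> \<open>The step lemmas treat a coordinate of their first index set, so
        \<open>I\<close> and \<open>J\<close> trade places by symmetry.\<close>
      assume "i \<in> J"
      then show ?thesis
        unfolding pos_correlated_sym[of M Y I]
        by (rule pos_correlated_shifted_step[OF IJ(2,1) JI])
          (use Y b cm[OF i] \<epsilon> e in \<open>auto simp: pos_correlated_sym[of M Y J]\<close>)
    qed
    then show "pos_correlated M Y I J h" by (simp flip: hi)
  qed
  \<comment> \<open>Singleton classes make the second pass another instance of
    \<open>coordinatewise_induct\<close>, now starting from the shifted functions.\<close>
  define L where "L j = {extend_to_zero (\<phi> j)}" for j
  define g where "g j n x = ennreal (\<phi> j (inverse (real (Suc n)) + max 0 x))" for j n x
  have gS: "g j n \<in> S j" for j n
    unfolding g_def S_def by (auto intro!: exI[of _ "inverse (real (Suc n))"])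
  have g_meas: "g j n \<in> borel_measurable borel" if "j \<in> I \<union> J" for j n
    using bounded[OF that, of "g j n"] gS by (simp add: bounded_test_def)
  have ext: "extend_to_zero (\<phi> j) = (\<lambda>x. SUP n. g j n x)" "incseq (\<lambda>n. g j n x)"
    if "j \<in> I \<union> J" for j x
    unfolding g_def using extend_to_zero_SUP[OF cm[OF that]] by auto
  have ext_meas: "extend_to_zero (\<phi> j) \<in> borel_measurable borel" if "j \<in> I \<union> J" for j
    unfolding ext(1)[OF that] using g_meas[OF that] by (intro borel_measurable_SUP) auto
  show ?thesis
  proof (rule coordinatewise_induct[OF fin, where P = "pos_correlated M Y I J" and A = S and B = L])
    show "pos_correlated M Y I J h" if "\<And>j. j \<in> I \<union> J \<Longrightarrow> h j \<in> S j" for h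
      using shifted that by blast
  next
    fix h i assume i: "i \<in> I \<union> J" and h: "\<And>j. j \<in> I \<union> J \<Longrightarrow> h j \<in> S j \<union> L j" and "h i \<in> L i"
      and S: "\<And>g. g \<in> S i \<Longrightarrow> pos_correlated M Y I J (h(i := g))"
    then have hi: "h i = (\<lambda>x. SUP n. g i n x)" using ext(1)[OF i] by (simp add: L_def)
    have m: "h j \<in> borel_measurable borel" if "j \<in> I \<union> J" for j
      using h[OF that] bounded[OF that, of "h j"] ext_meas[OF that]
      by (auto simp: L_def bounded_test_def)
    have e: "pos_correlated M Y I J (h(i := g i n))" for n by (rule S[OF gS])
    from i have "pos_correlated M Y I J (h(i := \<lambda>x. SUP n. g i n x))"
    proof
      assume "i \<in> I"
      then show ?thesis
        by (rule pos_correlated_SUP_step[OF IJ _ Y m g_meas[OF i] ext(2)[OF i] e])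
    next
      assume "i \<in> J"
      then show ?thesis
        unfolding pos_correlated_sym[of M Y I]
        by (rule pos_correlated_SUP_step[OF IJ(2,1) JI])
          (use Y m g_meas[OF i] ext(2)[OF i] e in \<open>auto simp: pos_correlated_sym[of M Y J]\<close>)
    qed
    then show "pos_correlated M Y I J h" by (simp flip: hi)
  qed (simp add: L_def)
qed

section \<open>The product inequality for trace-Wishart vectors\<close>

theorem theorem1:
  fixes M :: "'a measure" and d d1 :: nat and p :: "nat \<Rightarrow> nat" and \<alpha> :: real
    and \<Sigma> :: "real Matrix.mat" and X :: "nat \<Rightarrow> 'a \<Rightarrow> real" and \<phi> :: "nat \<Rightarrow> real \<Rightarrow> real"
  assumes "prob_space M"
    and "2 \<le> d"
    and "\<And>i. i \<in> {1..d} \<Longrightarrow> 1 \<le> p i"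
    and "(\<exists>n::nat. 1 \<le> n \<and> 2 * \<alpha> = real n) \<or> real (\<Sum>i=1..d. p i) - 1 < 2 * \<alpha>"
    and "symmetric_psd (\<Sum>i=1..d. p i) \<Sigma>"
    and "trace_wishart M d p \<alpha> \<Sigma> X"
    and "\<And>i. i \<in> {1..d} \<Longrightarrow> completely_monotone (\<phi> i)"
    and "1 \<le> d1" and "d1 \<le> d - 1"
    and "(\<integral>\<^sup>+\<omega>. (\<Prod>i=1..d. extend_to_zero (\<phi> i) (X i \<omega>)) \<partial>M) < \<infinity>"
    and "(\<integral>\<^sup>+\<omega>. (\<Prod>i=1..d1. extend_to_zero (\<phi> i) (X i \<omega>)) \<partial>M) < \<infinity>"
    and "(\<integral>\<^sup>+\<omega>. (\<Prod>i=d1+1..d. extend_to_zero (\<phi> i) (X i \<omega>)) \<partial>M) < \<infinity>"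
  shows "(\<integral>\<^sup>+\<omega>. (\<Prod>i=1..d. extend_to_zero (\<phi> i) (X i \<omega>)) \<partial>M)
      \<ge> (\<integral>\<^sup>+\<omega>. (\<Prod>i=1..d1. extend_to_zero (\<phi> i) (X i \<omega>)) \<partial>M)
        * (\<integral>\<^sup>+\<omega>. (\<Prod>i=d1+1..d. extend_to_zero (\<phi> i) (X i \<omega>)) \<partial>M)"
proof -
  interpret prob_space M by fact
  define D where "D t = Determinant.det (1\<^sub>m (\<Sum>i=1..d. p i) + diag_blocks d p t * \<Sigma>)" for t
  note D_ge_1 = trace_wishart_det_ge_1[OF assms(5), folded D_def]
    and D_submult = trace_wishart_det_submult[OF assms(5), folded D_def]
  have X[measurable]: "X i \<in> borel_measurable M" if "i \<in> {1..d}" for i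
    using assms(6) that by (simp add: trace_wishart_def)
  have laplace: "(\<integral>\<^sup>+\<omega>. ennreal (exp (- (\<Sum>i=1..d. t i * X i \<omega>))) \<partial>M) = ennreal (D t powr - \<alpha>)"
    if "\<And>i. i \<in> {1..d} \<Longrightarrow> 0 \<le> t i" for t
  proof -
    have "has_bochner_integral M (\<lambda>\<omega>. exp (- (\<Sum>i=1..d. t i * X i \<omega>))) (D t powr - \<alpha>)"
      using assms(6) that by (simp add: trace_wishart_def D_def)
    then show ?thesis
      by (subst nn_integral_eq_integral) (auto simp: has_bochner_integral_iff)
  qed
  \<comment> \<open>The total dimension is at least 1, so each of the two alternatives for
    \<open>\<alpha>\<close> makes it positive.\<close>
  have "1 \<le> p 1" using assms(2,3) by simp
  also have "p 1 \<le> (\<Sum>i=1..d. p i)" using assms(2) by (intro member_le_sum) auto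
  finally have "1 \<le> real (\<Sum>i=1..d. p i)" by linarith
  with assms(4) have \<alpha>: "0 < \<alpha>" by auto
  \<comment> \<open>Along the \<open>i\<close>-th axis the Laplace transform is a negative power of
    a determinant at least 1, hence bounded by 1.\<close>
  have nonneg: "AE \<omega> in M. 0 \<le> X i \<omega>" if i: "i \<in> {1..d}" for i
  proof (rule AE_nonneg_of_laplace_bounded[OF X[OF i], where C = 1])
    fix n :: nat
    let ?t = "\<lambda>j. if j = i then real n else 0"
    have "(\<Sum>j=1..d. ?t j * X j \<omega>) = real n * X i \<omega>" for \<omega>
      using i by (simp add: if_distrib[of "\<lambda>z. z * _"] sum.delta cong: if_cong)
    then have "(\<integral>\<^sup>+\<omega>. ennreal (exp (- (real n * X i \<omega>))) \<partial>M) = ennreal (D ?t powr - \<alpha>)"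
      using laplace[of ?t] by simp
    also have "D ?t powr - \<alpha> \<le> 1 powr - \<alpha>"
      using D_ge_1[of ?t] \<alpha> by (intro powr_mono2') auto
    finally show "(\<integral>\<^sup>+\<omega>. ennreal (exp (- (real n * X i \<omega>))) \<partial>M) \<le> ennreal 1"
      by (simp add: ennreal_leI)
  qed
  have AE_nonneg: "AE \<omega> in M. \<forall>i\<in>{1..d}. 0 \<le> X i \<omega>"
    using nonneg by (simp add: AE_finite_all)
  \<comment> \<open>Setting \<open>t j\<close> to 0 outside \<open>K\<close> gives the Laplace
    transform of the marginal on \<open>K\<close>; the truncation \<open>max 0\<close> disappears
    almost everywhere.\<close>
  have moment: "prod_moment M X K (\<lambda>j x. ennreal (exp (- (t j * max 0 x))))
      = ennreal (D (\<lambda>j. if j \<in> K then t j else 0) powr - \<alpha>)"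
    if K: "K \<subseteq> {1..d}" and t: "\<And>j. j \<in> {1..d} \<Longrightarrow> 0 \<le> t j" for K t
  proof -
    have "finite K" using K by (rule finite_subset) simp
    have "prod_moment M X K (\<lambda>j x. ennreal (exp (- (t j * max 0 x))))
        = (\<integral>\<^sup>+\<omega>. ennreal (exp (- (\<Sum>j=1..d. (if j \<in> K then t j else 0) * X j \<omega>))) \<partial>M)"
      unfolding prod_moment_def
    proof (rule nn_integral_cong_AE, use AE_nonneg in eventually_elim)
      case (elim \<omega>)
      have "(\<Prod>j\<in>K. ennreal (exp (- (t j * max 0 (X j \<omega>)))))
          = ennreal (exp (- (\<Sum>j\<in>K. t j * X j \<omega>)))"
        using K elim \<open>finite K\<close>
        by (auto simp: prod_ennreal exp_sum sum_negf[symmetric] subset_iff intro!: prod.cong)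
      also have "(\<Sum>j\<in>K. t j * X j \<omega>) = (\<Sum>j=1..d. (if j \<in> K then t j else 0) * X j \<omega>)"
        using K by (intro sum.mono_neutral_cong_left) auto
      finally show ?case .
    qed
    also have "\<dots> = ennreal (D (\<lambda>j. if j \<in> K then t j else 0) powr - \<alpha>)"
      by (rule laplace) (use t in auto)
    finally show ?thesis .
  qed
  have split: "{1..d1} \<union> {d1+1..d} = {1..d}" using assms(8,9) by auto
  have "pos_correlated M X {1..d1} {d1+1..d} (\<lambda>j. extend_to_zero (\<phi> j))"
  proof (rule pos_correlated_completely_monotone, unfold split)
    fix t :: "nat \<Rightarrow> real" assume t: "\<And>j. j \<in> {1..d} \<Longrightarrow> 0 \<le> t j"
    define r where "r K j = (if j \<in> K then t j else 0)" for K j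
    have r0: "0 \<le> r K j" if "j \<in> {1..d}" for K j using t[OF that] by (simp add: r_def)
    have ge: "1 \<le> D (r K)" for K by (rule D_ge_1) (rule r0)
    \<comment> \<open>The two index ranges are disjoint, so the restrictions of \<open>t\<close> to
      them add up without overlap.\<close>
    have "r {1..d} = (\<lambda>j. r {1..d1} j + r {d1+1..d} j)"
      using assms(8,9) by (auto simp: r_def fun_eq_iff)
    then have "D (r {1..d}) \<le> D (r {1..d1}) * D (r {d1+1..d})"
      using D_submult[of "r {1..d1}" "r {d1+1..d}"] r0 by simp
    \<comment> \<open>The exponent \<open>- \<alpha>\<close> is negative, so submultiplicativity of
      \<open>D\<close> turns into the reverse inequality for the Laplace transforms.\<close>
    then have "(D (r {1..d1}) * D (r {d1+1..d})) powr - \<alpha> \<le> D (r {1..d}) powr - \<alpha>"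
      using \<alpha> ge[of "{1..d}"] by (intro powr_mono2') auto
    then have "D (r {1..d1}) powr - \<alpha> * D (r {d1+1..d}) powr - \<alpha> \<le> D (r {1..d}) powr - \<alpha>"
      using ge[of "{1..d1}"] ge[of "{d1+1..d}"] by (simp add: powr_mult)
    moreover have "prod_moment M X K (\<lambda>j x. ennreal (exp (- (t j * max 0 x)))) = ennreal (D (r K) powr - \<alpha>)"
      if "K \<subseteq> {1..d}" for K
      using moment[OF that t] by (simp add: r_def[abs_def])
    moreover have "{1..d1} \<subseteq> {1..d}" "{d1+1..d} \<subseteq> {1..d}" using split by blast+
    ultimately show "pos_correlated M X {1..d1} {d1+1..d} (\<lambda>j x. ennreal (exp (- (t j * max 0 x))))"
      unfolding pos_correlated_def split by (simp add: ennreal_leI flip: ennreal_mult)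
  qed (use assms(7) X in auto)
  then show ?thesis
    unfolding pos_correlated_def prod_moment_def split by simp
qed

end
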